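(* Let $m \ge n \ge 1$, let $A \in \mathbb{C}^{m\times n}$ have full rank, let $b \in \mathbb{C}^m$ be such that the linear system $Ax = b$ is consistent, and let $x \in \mathbb{C}^n$ be its solution. Let $x_0 \in \mathbb{C}^n$ be an arbitrary initial approximation, and let $x_1, x_2, \ldots$ be the random iterates produced from $x_0$ by the random Kaczmarz algorithm applied to $Ax=b$. Then the algorithm converges to $x$ in expectation, with the average error $$\mathbb{E}\,\|x_k - x\|_2^2 \le \bigl(1 - \kappa(A)^{-2}\bigr)^k \cdot \|x_0 - x\|_2^2 \qquad \text{for all } k = 0, 1, 2, \ldots,$$ where $\kappa(A) = \|A\|_F \|A^{-1}\|_2$ is the scaled condition number of $A$.
   Context: Notation. $\|\cdot\|_2$ on vectors is the Euclidean norm, and $\langle u, v\rangle = u^* v$ is the standard inner product on $\mathbb{C}^n$. The rows of $A$ are denoted $a_1^*, \ldots, a_m^*$ with $a_j \in \mathbb{C}^n$, and $b = (b_1,\ldots,b_m)^T$, so that the $j$-th equation of the system $Ax=b$ is $\langle a_j, x\rangle = b_j$. $\|A\|_F$ is the Frobenius norm, so $\|A\|_F^2 = \sum_{j=1}^m \|a_j\|_2^2$. Since $A$ has full rank and $m \ge n$, it has a left inverse, denoted $A^{-1}$; the quantity $\|A^{-1}\|_2$ is the smallest constant $M$ such that $\|Az\|_2 \ge \frac{1}{M}\|z\|_2$ for all vectors $z \in \mathbb{C}^n$ (i.e. the reciprocal of the smallest singular value of $A$). The scaled condition number of $A$ is $\kappa(A) := \|A\|_F\|A^{-1}\|_2$.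 Random Kaczmarz algorithm. Starting from a fixed $x_0 \in \mathbb{C}^n$, for $k = 0, 1, 2, \ldots$ choose an index $r \in \{1,\ldots,m\}$ at random, independently of all previous choices, with $\mathbb{P}(r = j) = \|a_j\|_2^2/\|A\|_F^2$ for $j=1,\ldots,m$, and set $$x_{k+1} = x_k + \frac{b_r - \langle a_r, x_k\rangle}{\|a_r\|_2^2}\, a_r .$$ The expectation $\mathbb{E}$ is over all the random choices of indices. *)

theory Defs
  imports "HOL-Probability.Probability"
begin

text \<open>The standard inner product, conjugate-linear in its first argument. The library's
  \<open>inner\<close> on \<open>complex ^ 'n\<close> is only its real part.\<close>

definition cinner :: "complex ^ 'n \<Rightarrow> complex ^ 'n \<Rightarrow> complex" where
  "cinner u v = (\<Sum>i\<in>UNIV. cnj (u $ i) * v $ i)"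

text \<open>The vector \<open>a\<^sub>j\<close>: the \<open>j\<close>-th row of \<open>A\<close> is its conjugate transpose \<open>a\<^sub>j\<^sup>*\<close>, so that
  \<open>(A *v x) $ j = cinner (row_vec A j) x\<close>.\<close>

definition row_vec :: "complex ^ 'n ^ 'm \<Rightarrow> 'm \<Rightarrow> complex ^ 'n" where
  "row_vec A j = (\<chi> i. cnj (A $ j $ i))"

definition frob_norm :: "complex ^ 'n ^ 'm \<Rightarrow> real" where
  "frob_norm A = sqrt (\<Sum>j\<in>UNIV. \<Sum>i\<in>UNIV. (cmod (A $ j $ i))\<^sup>2)"

text \<open>The norm of the left inverse, as the smallest constant \<open>M\<close> with
  \<open>\<parallel>A z\<parallel> \<ge> \<parallel>z\<parallel> / M\<close> for all \<open>z\<close>. The condition \<open>M > 0\<close> is needed because \<open>1 / 0 = 0\<close> in HOL.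
  The minimum exists whenever \<open>A\<close> has full column rank.\<close>

definition left_inv_norm :: "complex ^ 'n ^ 'm \<Rightarrow> real" where
  "left_inv_norm A =
     (LEAST M. M > 0 \<and> (\<forall>z :: complex ^ 'n. norm (A *v z) \<ge> 1 / M * norm z))"

definition scaled_cond :: "complex ^ 'n ^ 'm \<Rightarrow> real" where
  "scaled_cond A = frob_norm A * left_inv_norm A"

text \<open>The iterates for a given sequence \<open>r\<close> of chosen indices. A zero row makes the step
  trivial (division by zero is zero), but such a row is chosen with probability zero.\<close>

primrec kaczmarz ::
  "complex ^ 'n ^ 'm \<Rightarrow> complex ^ 'm \<Rightarrow> complex ^ 'n \<Rightarrow> (nat \<Rightarrow> 'm) \<Rightarrow> nat \<Rightarrow> complex ^ 'n" where
  "kaczmarz A b x\<^sub>0 r 0 = x\<^sub>0"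
| "kaczmarz A b x\<^sub>0 r (Suc k) =
     (let y = kaczmarz A b x\<^sub>0 r k; a = row_vec A (r k)
      in y + ((b $ r k - cinner a y) / of_real ((norm a)\<^sup>2)) *s a)"

text \<open>The random indices are independent and \<open>j\<close> is chosen with probability
  \<open>\<parallel>a\<^sub>j\<parallel>\<^sup>2 / \<parallel>A\<parallel>\<^sub>F\<^sup>2\<close>; measurability of each \<open>r k\<close> is part of \<open>indep_vars\<close>.\<close>

definition kaczmarz_indices ::
  "'a measure \<Rightarrow> complex ^ 'n ^ 'm \<Rightarrow> (nat \<Rightarrow> 'a \<Rightarrow> 'm) \<Rightarrow> bool" where
  "kaczmarz_indices P A r \<longleftrightarrow>
     prob_space P \<and>
     prob_space.indep_vars P (\<lambda>_. count_space UNIV) r UNIV \<and>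
     (\<forall>k j. measure P {\<omega> \<in> space P. r k \<omega> = j} = (norm (row_vec A j))\<^sup>2 / (frob_norm A)\<^sup>2)"

end

theory Submission
  imports Defs
begin

text \<open>A Kaczmarz step projects the current iterate \<open>y\<close> orthogonally onto the hyperplane of the
  \<open>j\<close>-th equation. The solution \<open>x\<close> lies on that hyperplane, so by Pythagoras the squared
  error drops by exactly \<open>\<bar>\<langle>a\<^sub>j, y - x\<rangle>\<bar>\<^sup>2 / \<parallel>a\<^sub>j\<parallel>\<^sup>2\<close>. The probabilities
  \<open>\<parallel>a\<^sub>j\<parallel>\<^sup>2 / \<parallel>A\<parallel>\<^sub>F\<^sup>2\<close> are chosen so that they cancel these denominators: the mean drop is
  \<open>\<parallel>A (y - x)\<parallel>\<^sup>2 / \<parallel>A\<parallel>\<^sub>F\<^sup>2\<close>, which is at least \<open>\<parallel>y - x\<parallel>\<^sup>2 / \<kappa>(A)\<^sup>2\<close> by the definition of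
  \<open>\<parallel>A\<^sup>-\<^sup>1\<parallel>\<close>. This is \<open>mean_step_error\<close>.

  The index of step \<open>k\<close> is independent of the iterate \<open>X k\<close>, so the expected error of \<open>X (Suc k)\<close>
  may be computed by averaging over that index first, as in \<open>expectation_next_index\<close>. This
  multiplies the bound by \<open>1 - \<kappa>(A)\<^sup>-\<^sup>2\<close> at every step, and induction gives the estimate. Full
  rank makes \<open>\<kappa>(A)\<close> finite and positive, so the factor is below 1 and the error tends to 0.\<close>

section \<open>The left inverse norm and the scaled condition number\<close>

lemma full_column_rank_injective:
  fixes A :: "'a::field ^ 'n ^ 'm"
  assumes "rank A = CARD('n)"
  shows "inj ((*v) A)"
proof -
  have "vec.span (rows A) = UNIV"
    using assms by (simp add: row_rank_def_gen vec.dim_eq_full[symmetric] card_cart_basis vec.dimension_def)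
  then show ?thesis
    by (simp add: matrix_left_invertible_injective[symmetric] matrix_left_invertible_span_rows_gen)
qed

text \<open>The set of admissible constants is nonempty because an injective linear map on a
  finite-dimensional space is bounded below. It is closed and bounded below by 0, so it contains
  its infimum; hence the \<open>LEAST\<close> in the definition is attained.\<close>

lemma left_inv_norm_least:
  fixes A :: "complex ^ 'n ^ 'm"
  assumes inj: "inj ((*v) A)"
  shows left_inv_norm_pos: "left_inv_norm A > 0"
    and norm_le_left_inv_norm: "norm z \<le> left_inv_norm A * norm (A *v z)"
proof -
  define S where "S = {M. \<forall>z :: complex ^ 'n. norm z \<le> M * norm (A *v z)}"
  have S_pos: "M > 0" if "M \<in> S" for M
  proof -
    define e :: "complex ^ 'n" where "e = axis undefined 1"
    have "0 < norm e"
      by (simp add: e_def axis_eq_0_iff)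
    also have "\<dots> \<le> M * norm (A *v e)"
      using that by (simp add: S_def)
    finally show ?thesis
      by (metis norm_ge_zero not_less zero_less_mult_pos2 mult_nonpos_nonneg)
  qed
  \<comment> \<open>A nonzero \<open>z\<close> exists, which forces the positivity that the definition asks for; without
    that strict inequality the set is visibly closed.\<close>
  have S_eq: "M \<in> S \<longleftrightarrow> M > 0 \<and> (\<forall>z :: complex ^ 'n. norm (A *v z) \<ge> 1 / M * norm z)" for M
    using S_pos[of M] by (auto simp: S_def field_simps)
  have "linear ((*v) A)"
    by (rule linearI)
       (simp_all add: matrix_vector_right_distrib, simp add: vec_eq_iff
        matrix_vector_mult_def scaleR_sum_right)
  then obtain B where "B > 0" "\<And>z. B * norm z \<le> norm (A *v z)"
    using linear_inj_bounded_below_pos[OF _ inj] by blast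
  then have "1 / B \<in> S"
    by (auto simp: S_def field_simps)
  then have "S \<noteq> {}" by blast
  moreover have "bdd_below S"
    using S_pos by (meson bdd_belowI less_imp_le)
  moreover have "closed S"
    unfolding S_def by (intro closed_Collect_all closed_Collect_le continuous_intros)
  ultimately have "Inf S \<in> S"
    by (rule closed_contains_Inf)
  moreover have "left_inv_norm A = Inf S"
    unfolding left_inv_norm_def S_eq[symmetric]
    using \<open>Inf S \<in> S\<close> \<open>bdd_below S\<close> by (intro Least_equality) (auto intro: cInf_lower)
  ultimately have "left_inv_norm A \<in> S" by simp
  then show "left_inv_norm A > 0" "norm z \<le> left_inv_norm A * norm (A *v z)"
    using S_pos by (auto simp: S_def)
qed

lemma norm_vec_squared: "(norm (v :: complex ^ 'n))\<^sup>2 = (\<Sum>i\<in>UNIV. (cmod (v $ i))\<^sup>2)"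
  by (simp add: norm_vec_def L2_set_def sum_nonneg)

lemma frob_norm_squared: "(frob_norm A)\<^sup>2 = (\<Sum>j\<in>UNIV. (norm (row_vec A j))\<^sup>2)"
  by (simp add: frob_norm_def norm_vec_squared row_vec_def sum_nonneg)

lemma frob_norm_pos:
  fixes A :: "complex ^ 'n ^ 'm"
  assumes "inj ((*v) A)"
  shows "frob_norm A > 0"
proof -
  have "frob_norm A \<noteq> 0"
  proof
    assume "frob_norm A = 0"
    then have "(\<Sum>j\<in>UNIV. (norm (row_vec A j))\<^sup>2) = 0"
      by (simp flip: frob_norm_squared)
    then have "A = 0"
      by (simp add: sum_nonneg_eq_0_iff) (simp add: row_vec_def vec_eq_iff)
    then show False
      using injD[OF assms, of "axis undefined 1" 0] by (simp add: axis_eq_0_iff)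
  qed
  moreover have "frob_norm A \<ge> 0"
    by (simp add: frob_norm_def sum_nonneg)
  ultimately show ?thesis by simp
qed

lemma cinner_row_vec: "cinner (row_vec A j) z = (A *v z) $ j"
  by (simp add: cinner_def row_vec_def matrix_vector_mult_def)

text \<open>The Frobenius norm enters \<open>\<kappa>(A)\<close> only through the normalisation of the probabilities; the
  content is the lower bound on \<open>\<parallel>A z\<parallel>\<close>, in the form in which the mean drop of the error is
  estimated.\<close>

lemma condition_number_bound:
  fixes A :: "complex ^ 'n ^ 'm"
  assumes "inj ((*v) A)"
  shows "(norm z)\<^sup>2 / (scaled_cond A)\<^sup>2 \<le> (norm (A *v z))\<^sup>2 / (frob_norm A)\<^sup>2"
proof -
  have "(norm z)\<^sup>2 \<le> (left_inv_norm A * norm (A *v z))\<^sup>2"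
    by (intro power_mono norm_le_left_inv_norm assms) simp
  then show ?thesis
    using frob_norm_pos[OF assms] left_inv_norm_pos[OF assms]
    by (simp add: scaled_cond_def power_mult_distrib field_simps)
qed

section \<open>One projection step\<close>

definition kaczmarz_step ::
  "complex ^ 'n ^ 'm \<Rightarrow> complex ^ 'm \<Rightarrow> complex ^ 'n \<Rightarrow> 'm \<Rightarrow> complex ^ 'n" where
  "kaczmarz_step A b y j =
     y + ((b $ j - cinner (row_vec A j) y) / of_real ((norm (row_vec A j))\<^sup>2)) *s row_vec A j"

lemma kaczmarz_Suc: "kaczmarz A b x\<^sub>0 r (Suc k) = kaczmarz_step A b (kaczmarz A b x\<^sub>0 r k) (r k)"
  by (simp add: kaczmarz_step_def Let_def)

lemma norm_diff_smult_squared: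
  "(norm (e - t *s a))\<^sup>2 = (norm e)\<^sup>2 - 2 * Re (cnj t * cinner a e) + (cmod t)\<^sup>2 * (norm a)\<^sup>2"
proof -
  have "(cmod (u - t * v))\<^sup>2 = (cmod u)\<^sup>2 - 2 * Re (cnj t * (cnj v * u)) + (cmod t)\<^sup>2 * (cmod v)\<^sup>2" for u v
    unfolding cmod_power2 by (simp add: algebra_simps power2_eq_square)
  then show ?thesis
    by (simp add: norm_vec_squared cinner_def sum.distrib sum_subtractf sum_distrib_left)
qed

text \<open>Pythagoras: the subtracted vector is the component of \<open>e\<close> along \<open>a\<close>, and what remains is
  orthogonal to it.\<close>

lemma norm_orthogonal_projection_squared:
  assumes "a \<noteq> 0"
  shows "(norm (e - (cinner a e / of_real ((norm a)\<^sup>2)) *s a))\<^sup>2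
    = (norm e)\<^sup>2 - (cmod (cinner a e))\<^sup>2 / (norm a)\<^sup>2"
proof -
  define c where "c = cinner a e"
  define s where "s = (norm a)\<^sup>2"
  have "s > 0" using assms by (simp add: s_def)
  have "Re (cnj (c / of_real s) * c) = (cmod c)\<^sup>2 / s"
    by (simp add: cmod_power2 add_divide_distrib flip: power2_eq_square)
  moreover have "(cmod (c / of_real s))\<^sup>2 * s = (cmod c)\<^sup>2 / s"
    using \<open>s > 0\<close> by (simp add: norm_divide power_divide power2_eq_square)
  ultimately show ?thesis
    unfolding norm_diff_smult_squared c_def[symmetric] s_def[symmetric] by linarith
qed

text \<open>Multiplying by the weight \<open>\<parallel>a\<^sub>j\<parallel>\<^sup>2\<close> clears the denominator in Pythagoras' identity. The
  equation then also covers a zero row, for which both sides vanish.\<close>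

lemma weighted_step_error:
  fixes A :: "complex ^ 'n ^ 'm"
  assumes "A *v x = b"
  defines "a \<equiv> row_vec A"
  shows "(norm (a j))\<^sup>2 * (norm (kaczmarz_step A b y j - x))\<^sup>2
    = (norm (a j))\<^sup>2 * (norm (y - x))\<^sup>2 - (cmod ((A *v (y - x)) $ j))\<^sup>2"
proof (cases "a j = 0")
  case True
  then have "(A *v (y - x)) $ j = 0"
    by (simp flip: cinner_row_vec add: a_def cinner_def)
  then show ?thesis using True by simp
next
  case False
  \<comment> \<open>Consistency turns the residual of equation \<open>j\<close> into an inner product with the error, so
    that the step subtracts from the error its component along \<open>a j\<close>.\<close>
  have "b $ j - cinner (a j) y = - cinner (a j) (y - x)"
    by (simp add: a_def cinner_row_vec assms(1)[symmetric] matrix_vector_mult_diff_distrib)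
  then have "kaczmarz_step A b y j - x
    = (y - x) - (cinner (a j) (y - x) / of_real ((norm (a j))\<^sup>2)) *s a j"
    by (simp add: kaczmarz_step_def a_def vec_eq_iff)
  then show ?thesis
    using False
    by (simp only: norm_orthogonal_projection_squared[OF False])
       (simp add: a_def cinner_row_vec right_diff_distrib)
qed

lemma mean_step_error:
  fixes A :: "complex ^ 'n ^ 'm"
  assumes inj: "inj ((*v) A)" and sol: "A *v x = b"
  shows "(\<Sum>j\<in>UNIV. (norm (row_vec A j))\<^sup>2 / (frob_norm A)\<^sup>2 * (norm (kaczmarz_step A b y j - x))\<^sup>2)
    \<le> (1 - 1 / (scaled_cond A)\<^sup>2) * (norm (y - x))\<^sup>2"
proof -
  have "(\<Sum>j\<in>UNIV. (norm (row_vec A j))\<^sup>2 / (frob_norm A)\<^sup>2 * (norm (kaczmarz_step A b y j - x))\<^sup>2)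
    = (\<Sum>j\<in>UNIV. (norm (row_vec A j))\<^sup>2 * (norm (y - x))\<^sup>2 - (cmod ((A *v (y - x)) $ j))\<^sup>2)
        / (frob_norm A)\<^sup>2"
    by (simp add: weighted_step_error[OF sol] sum_divide_distrib)
  also have "\<dots> = (norm (y - x))\<^sup>2 - (norm (A *v (y - x)))\<^sup>2 / (frob_norm A)\<^sup>2"
    using frob_norm_pos[OF inj]
    by (simp add: sum_subtractf norm_vec_squared[of "A *v (y - x)"] diff_divide_distrib
        flip: sum_distrib_right frob_norm_squared)
  also have "\<dots> \<le> (1 - 1 / (scaled_cond A)\<^sup>2) * (norm (y - x))\<^sup>2"
    using condition_number_bound[OF inj, of "y - x"] by (simp add: algebra_simps)
  finally show ?thesis .
qed

text \<open>The lower bound, that is \<open>\<kappa>(A) \<ge> 1\<close>, comes for free: a mean of squared errors is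
  nonnegative, and it is at most the factor times a positive number.\<close>

lemma contraction_factor_bounds:
  fixes A :: "complex ^ 'n ^ 'm"
  assumes "inj ((*v) A)"
  shows "0 \<le> 1 - 1 / (scaled_cond A)\<^sup>2" "1 - 1 / (scaled_cond A)\<^sup>2 < 1"
proof -
  define e :: "complex ^ 'n" where "e = axis undefined 1"
  have "0 \<le> (\<Sum>j\<in>UNIV. (norm (row_vec A j))\<^sup>2 / (frob_norm A)\<^sup>2
      * (norm (kaczmarz_step A 0 e j - 0))\<^sup>2)"
    by (intro sum_nonneg mult_nonneg_nonneg) auto
  also have "\<dots> \<le> (1 - 1 / (scaled_cond A)\<^sup>2) * (norm (e - 0))\<^sup>2"
    by (intro mean_step_error assms) simp
  finally have "0 \<le> (1 - 1 / (scaled_cond A)\<^sup>2) * (norm e)\<^sup>2" by simp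
  moreover have "(norm e)\<^sup>2 > 0"
    by (simp add: e_def axis_eq_0_iff)
  ultimately show "0 \<le> 1 - 1 / (scaled_cond A)\<^sup>2"
    by (simp only: zero_le_mult_iff) linarith
  show "1 - 1 / (scaled_cond A)\<^sup>2 < 1"
    using frob_norm_pos[OF assms] left_inv_norm_pos[OF assms] by (simp add: scaled_cond_def)
qed

section \<open>Averaging over an independent index\<close>

lemma (in prob_space) measurable_past:
  assumes "indep_vars (\<lambda>_. count_space UNIV) r (UNIV :: nat set)"
  shows "(\<lambda>\<omega>. restrict (\<lambda>i. r i \<omega>) {..<k}) \<in> measurable M (PiM {..<k} (\<lambda>_. count_space UNIV))"
  using assms by (intro measurable_restrict) (auto simp: indep_vars_def2)

text \<open>Finitely many indices from a finite set have only finitely many possible outcomes, so every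
  function of them is bounded and measurable.\<close>

lemma (in prob_space) integrable_past:
  fixes r :: "nat \<Rightarrow> 'a \<Rightarrow> 'j::finite" and F :: "(nat \<Rightarrow> 'j) \<Rightarrow> real"
  assumes "indep_vars (\<lambda>_. count_space UNIV) r UNIV"
  shows "integrable M (\<lambda>\<omega>. F (restrict (\<lambda>i. r i \<omega>) {..<k}))"
proof -
  let ?H = "{..<k} \<rightarrow>\<^sub>E (UNIV :: 'j set)"
  have "norm (F (restrict (\<lambda>i. r i \<omega>) {..<k})) \<le> Max ((\<lambda>\<rho>. norm (F \<rho>)) ` ?H)" for \<omega>
    by (intro Max_ge finite_imageI finite_PiE imageI restrict_PiE_iff[THEN iffD2] ballI) auto
  moreover have "F \<in> borel_measurable (PiM {..<k} (\<lambda>_. count_space UNIV))"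
    by (simp add: count_space_PiM_finite)
  ultimately show ?thesis
    using measurable_past[OF assms]
    by (intro integrable_const_bound[where B = "Max ((\<lambda>\<rho>. norm (F \<rho>)) ` ?H)"]) auto
qed

text \<open>Conditioning on the next index without conditional expectations: as the index has finitely
  many values, split according to its value \<open>j\<close>. The indicator of \<open>r k = j\<close> is independent of any
  function of the past, so each expectation of a product factorises.\<close>

lemma (in prob_space) expectation_next_index:
  fixes r :: "nat \<Rightarrow> 'a \<Rightarrow> 'j::finite" and k :: nat and F :: "'j \<Rightarrow> (nat \<Rightarrow> 'j) \<Rightarrow> real"
  assumes indep: "indep_vars (\<lambda>_. count_space UNIV) r UNIV"
  defines "past \<equiv> \<lambda>\<omega>. restrict (\<lambda>i. r i \<omega>) {..<k}"
  shows "expectation (\<lambda>\<omega>. F (r k \<omega>) (past \<omega>))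
    = (\<Sum>j\<in>UNIV. prob {\<omega> \<in> space M. r k \<omega> = j} * expectation (\<lambda>\<omega>. F j (past \<omega>)))"
proof -
  let ?C = "count_space UNIV :: 'j measure"
  have [measurable]: "r k \<in> measurable M ?C"
    using indep by (simp add: indep_vars_def2)
  have "indep_var (PiM {..<k} (\<lambda>_. ?C)) past (PiM {k} (\<lambda>_. ?C)) (\<lambda>\<omega>. restrict (\<lambda>i. r i \<omega>) {k})"
    unfolding past_def using indep by (rule indep_var_restrict) auto
  moreover have "F j \<in> borel_measurable (PiM {..<k} (\<lambda>_. ?C))" for j
    by (simp add: count_space_PiM_finite)
  moreover have "(\<lambda>\<rho>. indicator {j} (\<rho> k) :: real) \<in> borel_measurable (PiM {k} (\<lambda>_. ?C))" for j
    by (simp add: count_space_PiM_finite)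
  ultimately have "indep_var borel (F j \<circ> past)
      borel ((\<lambda>\<rho>. indicator {j} (\<rho> k)) \<circ> (\<lambda>\<omega>. restrict (\<lambda>i. r i \<omega>) {k}))" for j
    by (rule indep_var_compose)
  then have ind: "indep_var borel (\<lambda>\<omega>. F j (past \<omega>)) borel (\<lambda>\<omega>. indicator {j} (r k \<omega>) :: real)" for j
    by (simp add: o_def)
  have int: "integrable M (\<lambda>\<omega>. F j (past \<omega>))" for j
    unfolding past_def by (rule integrable_past[OF indep])
  have int_ind: "integrable M (\<lambda>\<omega>. indicator {j} (r k \<omega>) :: real)" for j
    by (rule integrable_const_bound[where B = 1]) (auto simp: indicator_def)
  have exp_ind: "expectation (\<lambda>\<omega>. indicator {j} (r k \<omega>)) = prob {\<omega> \<in> space M. r k \<omega> = j}" for j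
  proof -
    have "expectation (\<lambda>\<omega>. indicator {j} (r k \<omega>))
        = expectation (indicator {\<omega> \<in> space M. r k \<omega> = j})"
      by (rule Bochner_Integration.integral_cong) (auto simp: indicator_def)
    also have "\<dots> = prob ({\<omega> \<in> space M. r k \<omega> = j} \<inter> space M)"
      by (rule Bochner_Integration.integral_indicator)
    also have "{\<omega> \<in> space M. r k \<omega> = j} \<inter> space M = {\<omega> \<in> space M. r k \<omega> = j}"
      by blast
    finally show ?thesis .
  qed
  have expand: "F (r k \<omega>) (past \<omega>) = (\<Sum>j\<in>UNIV. F j (past \<omega>) * indicator {j} (r k \<omega>))" for \<omega>
    by (simp add: indicator_def if_distrib sum.delta cong: if_cong)
  show ?thesis
    unfolding expand
    by (subst Bochner_Integration.integral_sum)
      (simp_all add: indep_var_integrable[OF ind int int_ind]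
        indep_var_lebesgue_integral[OF ind int int_ind] exp_ind mult.commute)
qed

section \<open>The error recursion\<close>

text \<open>The \<open>k\<close>-th iterate depends only on the first \<open>k\<close> indices, hence it is independent of index
  number \<open>k\<close> (they are counted from 0).\<close>

lemma kaczmarz_restrict: "kaczmarz A b x\<^sub>0 (restrict \<rho> {..<k}) k = kaczmarz A b x\<^sub>0 \<rho> k"
proof -
  have "kaczmarz A b x\<^sub>0 (restrict \<rho> {..<k}) i = kaczmarz A b x\<^sub>0 \<rho> i" if "i \<le> k" for i
    using that by (induction i) (simp_all add: Let_def)
  then show ?thesis by simp
qed

lemma integrable_kaczmarz:
  fixes A :: "complex ^ 'n ^ 'm" and f :: "complex ^ 'n \<Rightarrow> real"
  assumes "kaczmarz_indices P A r"
  shows "integrable P (\<lambda>\<omega>. f (kaczmarz A b x\<^sub>0 (\<lambda>i. r i \<omega>) k))"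
proof -
  interpret prob_space P using assms by (simp add: kaczmarz_indices_def)
  show ?thesis
    using integrable_past[of r "\<lambda>\<rho>. f (kaczmarz A b x\<^sub>0 \<rho> k)" k] assms
    by (simp add: kaczmarz_indices_def kaczmarz_restrict)
qed

lemma expected_error_step:
  fixes A :: "complex ^ 'n ^ 'm" and x\<^sub>0 :: "complex ^ 'n"
  assumes inj: "inj ((*v) A)" and sol: "A *v x = b" and idx: "kaczmarz_indices P A r"
  defines "X \<equiv> \<lambda>k \<omega>. kaczmarz A b x\<^sub>0 (\<lambda>i. r i \<omega>) k"
  shows "integral\<^sup>L P (\<lambda>\<omega>. (norm (X (Suc k) \<omega> - x))\<^sup>2)
    \<le> (1 - 1 / (scaled_cond A)\<^sup>2) * integral\<^sup>L P (\<lambda>\<omega>. (norm (X k \<omega> - x))\<^sup>2)"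
proof -
  interpret prob_space P using idx by (simp add: kaczmarz_indices_def)
  define g where "g j y = (norm (kaczmarz_step A b y j - x))\<^sup>2" for j y
  have int: "integrable P (\<lambda>\<omega>. f (X k \<omega>))" for f :: "_ \<Rightarrow> real"
    unfolding X_def by (rule integrable_kaczmarz[OF idx])
  have "expectation (\<lambda>\<omega>. (norm (X (Suc k) \<omega> - x))\<^sup>2) = expectation (\<lambda>\<omega>. g (r k \<omega>) (X k \<omega>))"
    by (simp add: g_def X_def kaczmarz_Suc del: kaczmarz.simps)
  also have "\<dots> = (\<Sum>j\<in>UNIV. prob {\<omega> \<in> space P. r k \<omega> = j} * expectation (\<lambda>\<omega>. g j (X k \<omega>)))"
    using expectation_next_index[of r "\<lambda>j \<rho>. g j (kaczmarz A b x\<^sub>0 \<rho> k)" k] idx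
    by (simp add: kaczmarz_indices_def kaczmarz_restrict X_def)
  also have "\<dots> = expectation
      (\<lambda>\<omega>. \<Sum>j\<in>UNIV. (norm (row_vec A j))\<^sup>2 / (frob_norm A)\<^sup>2 * g j (X k \<omega>))"
    using idx int by (simp add: kaczmarz_indices_def)
  also have "\<dots> \<le> expectation (\<lambda>\<omega>. (1 - 1 / (scaled_cond A)\<^sup>2) * (norm (X k \<omega> - x))\<^sup>2)"
    unfolding g_def using mean_step_error[OF inj sol] by (intro integral_mono int)
  finally show ?thesis by simp
qed

theorem theorem2:
  fixes A :: "complex ^ 'n ^ 'm" and b :: "complex ^ 'm"
    and x x\<^sub>0 :: "complex ^ 'n"
    and P :: "'a measure" and r :: "nat \<Rightarrow> 'a \<Rightarrow> 'm"
  assumes "CARD('m) \<ge> CARD('n)"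
    and "rank A = min CARD('m) CARD('n)"
    and "A *v x = b"
    and "kaczmarz_indices P A r"
  defines "X \<equiv> \<lambda>k \<omega>. kaczmarz A b x\<^sub>0 (\<lambda>i. r i \<omega>) k"
  shows "(\<lambda>k. integral\<^sup>L P (\<lambda>\<omega>. (norm (X k \<omega> - x))\<^sup>2)) \<longlonglongrightarrow> 0 \<and>
    (\<forall>k. integrable P (\<lambda>\<omega>. (norm (X k \<omega> - x))\<^sup>2) \<and>
         integral\<^sup>L P (\<lambda>\<omega>. (norm (X k \<omega> - x))\<^sup>2)
           \<le> (1 - 1 / (scaled_cond A)\<^sup>2) ^ k * (norm (x\<^sub>0 - x))\<^sup>2)"
proof -
  interpret prob_space P using assms(4) by (simp add: kaczmarz_indices_def)
  have inj: "inj ((*v) A)"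
    using assms(1,2) by (intro full_column_rank_injective) simp
  define q where "q = 1 - 1 / (scaled_cond A)\<^sup>2"
  have q: "0 \<le> q" "q < 1"
    using contraction_factor_bounds[OF inj] by (simp_all add: q_def)
  have bound: "expectation (\<lambda>\<omega>. (norm (X k \<omega> - x))\<^sup>2) \<le> q ^ k * (norm (x\<^sub>0 - x))\<^sup>2" for k
  proof (induction k)
    case 0
    then show ?case by (simp add: X_def prob_space)
  next
    case (Suc k)
    have "expectation (\<lambda>\<omega>. (norm (X (Suc k) \<omega> - x))\<^sup>2)
      \<le> q * expectation (\<lambda>\<omega>. (norm (X k \<omega> - x))\<^sup>2)"
      unfolding X_def q_def by (rule expected_error_step[OF inj assms(3,4)])
    also have "\<dots> \<le> q * (q ^ k * (norm (x\<^sub>0 - x))\<^sup>2)"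
      using Suc q(1) by (rule mult_left_mono)
    finally show ?case by (simp add: mult.assoc)
  qed
  have "(\<lambda>k. q ^ k * (norm (x\<^sub>0 - x))\<^sup>2) \<longlonglongrightarrow> 0"
    using q by (intro tendsto_mult_left_zero LIMSEQ_power_zero) simp
  then have "(\<lambda>k. expectation (\<lambda>\<omega>. (norm (X k \<omega> - x))\<^sup>2)) \<longlonglongrightarrow> 0"
    by (rule tendsto_sandwich[OF _ _ tendsto_const, rotated 2]) (simp_all add: bound)
  moreover have "integrable P (\<lambda>\<omega>. (norm (X k \<omega> - x))\<^sup>2)" for k
    unfolding X_def by (rule integrable_kaczmarz[OF assms(4)])
  ultimately show ?thesis
    using bound by (simp add: q_def)
qed

end
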